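(* Let $n$ be a positive integer and let $\mathcal{F} = \{K_{t,n-t} : t \in \{1,2,\ldots,\lfloor n/2\rfloor\}\}$ be the family of all complete bipartite graphs on $n$ vertices. Then \[ r_{odd}(n,\mathcal{F}) = \begin{cases} n-1 & \text{if } n \text{ is even},\\ n & \text{if } n \text{ is odd}.\end{cases} \]
   Context: $K_n$ is the complete graph on vertex set $[n]=\{1,\ldots,n\}$, and $K_{a,b}$ is the complete bipartite graph with parts of sizes $a$ and $b$. A copy of a graph $H$ in $K_n$ is a (not necessarily induced) subgraph of $K_n$ isomorphic to $H$. For a positive integer $r$, an $r$-colouring $G_1,\ldots,G_r$ of $K_n$ is a partition of the edge set of $K_n$ into $r$ (possibly empty) colour classes. A copy of $H$ has an odd colour class if it contains an odd number of edges of $G_i$ for some $i$. For a family $\mathcal{H}$ of graphs, the odd-Ramsey number $r_{odd}(n,\mathcal{H})$ is the minimum positive integer $r$ for which there exists an $r$-colouring of $K_n$ such that every copy in $K_n$ of every graph $H\in\mathcal{H}$ has an odd colour class. *)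

theory Defs
  imports Main "HOL-Library.Ramsey" "HOL-Library.Disjoint_Sets"
begin

text \<open>A graph is a pair of a vertex set \<open>V\<close> and an edge set, which for a simple graph
  consists of two-element subsets of \<open>V\<close>, i.e. is contained in \<^term>\<open>[V]\<^bsup>2\<^esup>\<close>.\<close>

type_synonym 'a ugraph = "'a set \<times> 'a set set"

definition verts :: "'a ugraph \<Rightarrow> 'a set" where
  "verts G = fst G"

definition edges :: "'a ugraph \<Rightarrow> 'a set set" where
  "edges G = snd G"

definition simple_graph :: "'a ugraph \<Rightarrow> bool" where
  "simple_graph G \<longleftrightarrow> edges G \<subseteq> [verts G]\<^bsup>2\<^esup>"

definition subgraph :: "'a ugraph \<Rightarrow> 'a ugraph \<Rightarrow> bool" where
  "subgraph C G \<longleftrightarrow> simple_graph C \<and> verts C \<subseteq> verts G \<and> edges C \<subseteq> edges G"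

definition isomorphic :: "'a ugraph \<Rightarrow> 'b ugraph \<Rightarrow> bool" where
  "isomorphic G H \<longleftrightarrow> (\<exists>f. bij_betw f (verts G) (verts H) \<and> edges H = image f ` edges G)"

definition copies :: "'a ugraph \<Rightarrow> 'b ugraph \<Rightarrow> 'b ugraph set" where
  "copies H G = {C. subgraph C G \<and> isomorphic H C}"

definition complete_graph :: "nat \<Rightarrow> nat ugraph" where
  "complete_graph n = ({1..n}, [{1..n}]\<^bsup>2\<^esup>)"

definition complete_bipartite :: "nat \<Rightarrow> nat \<Rightarrow> (nat + nat) ugraph" where
  "complete_bipartite a b =
     ({1..a} <+> {1..b}, {{Inl x, Inr y} | x y. x \<in> {1..a} \<and> y \<in> {1..b}})"

text \<open>Only the values of \<open>c\<close> on \<open>{1..r}\<close> matter; colour classes may be empty, which is why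
  this is an indexed family rather than \<^const>\<open>partition_on\<close>.\<close>

definition edge_colouring :: "nat \<Rightarrow> (nat \<Rightarrow> 'a set set) \<Rightarrow> 'a ugraph \<Rightarrow> bool" where
  "edge_colouring r c G \<longleftrightarrow> disjoint_family_on c {1..r} \<and> (\<Union>i\<in>{1..r}. c i) = edges G"

definition has_odd_colour_class :: "nat \<Rightarrow> (nat \<Rightarrow> 'a set set) \<Rightarrow> 'a ugraph \<Rightarrow> bool" where
  "has_odd_colour_class r c C \<longleftrightarrow> (\<exists>i\<in>{1..r}. odd (card (edges C \<inter> c i)))"

text \<open>The minimum exists whenever every member of \<open>\<H>\<close> has an edge, since the colouring
  with pairwise distinct colours then qualifies (any single class does if \<open>n \<le> 1\<close>);
  otherwise \<^const>\<open>Least\<close> may be unspecified.\<close>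

definition odd_ramsey :: "nat \<Rightarrow> 'a ugraph set \<Rightarrow> nat" where
  "odd_ramsey n \<H> = (LEAST r. 0 < r \<and>
     (\<exists>c. edge_colouring r c (complete_graph n) \<and>
          (\<forall>H\<in>\<H>. \<forall>C\<in>copies H (complete_graph n). has_odd_colour_class r c C)))"

end

theory Submission
  imports Defs
begin

text \<open>A copy of \<open>K\<^bsub>t,n-t\<^esub>\<close> in \<open>K\<^bsub>n\<^esub>\<close> is a cut, and the cut of a symmetric difference is the
  symmetric difference of the cuts. Hence, for a set of fewer than \<open>n - 1\<close> colours, two of the
  \<open>2\<^bsup>n-1\<^esup>\<close> vertex sets avoiding a given vertex have cuts with the same parities in those
  colours, and their symmetric difference gives a cut that is even in all of them. For odd \<open>n\<close>
  every cut has an even number of edges, so one further colour is even automatically. For the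
  upper bound, give the edges at the vertex \<open>n\<close> distinct colours; the other edges receive
  a new colour if \<open>n\<close> is odd, and the colour of the edge \<open>{1, n}\<close> if \<open>n\<close> is even.\<close>

section \<open>Cuts and their parities\<close>

definition cut_edges :: "'a set \<Rightarrow> 'a set \<Rightarrow> 'a set set" where
  "cut_edges V S = {{x, y} | x y. x \<in> S \<and> y \<in> V - S}"

lemma cut_Diff: "S \<subseteq> V \<Longrightarrow> cut_edges V (V - S) = cut_edges V S"
  unfolding cut_edges_def by (auto simp: double_diff insert_commute)

lemma doubleton_in_cut_iff:
  assumes "S \<subseteq> V" "x \<in> V" "y \<in> V"
  shows "{x, y} \<in> cut_edges V S \<longleftrightarrow> (x \<in> S) \<noteq> (y \<in> S)"
  using assms unfolding cut_edges_def by (auto simp: doubleton_eq_iff)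

lemma cut_subset_nsets: "S \<subseteq> V \<Longrightarrow> cut_edges V S \<subseteq> [V]\<^bsup>2\<^esup>"
  unfolding cut_edges_def by (auto simp: nsets_def card_insert_if)

lemma finite_cut:
  assumes "finite V" "S \<subseteq> V"
  shows "finite (cut_edges V S)"
  using finite_subset[OF cut_subset_nsets[OF assms(2)] finite_imp_finite_nsets[OF assms(1)]] .

lemma cut_sym_diff:
  assumes "S \<subseteq> V" "T \<subseteq> V"
  shows "cut_edges V (sym_diff S T) = sym_diff (cut_edges V S) (cut_edges V T)"
proof -
  have sub: "sym_diff S T \<subseteq> V" using assms by auto
  have "e \<in> cut_edges V (sym_diff S T) \<longleftrightarrow> e \<in> sym_diff (cut_edges V S) (cut_edges V T)" if e: "e \<in> [V]\<^bsup>2\<^esup>" for e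
  proof -
    obtain x y where "e = {x, y}" "x \<in> V" "y \<in> V"
      using e by (auto simp: nsets_def card_2_iff)
    then show ?thesis
      using doubleton_in_cut_iff[OF sub] doubleton_in_cut_iff[OF assms(1)]
        doubleton_in_cut_iff[OF assms(2)] by auto
  qed
  then show ?thesis
    using cut_subset_nsets[OF sub] cut_subset_nsets[OF assms(1)] cut_subset_nsets[OF assms(2)]
    by blast
qed

lemma card_cut:
  assumes "S \<subseteq> V"
  shows "card (cut_edges V S) = card S * card (V - S)"
proof -
  have "cut_edges V S = (\<lambda>(x, y). {x, y}) ` (S \<times> (V - S))"
    unfolding cut_edges_def by auto
  moreover have "inj_on (\<lambda>(x, y). {x, y}) (S \<times> (V - S))"
    by (auto simp: inj_on_def doubleton_eq_iff)
  ultimately show ?thesis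
    by (simp add: card_image card_cartesian_product)
qed

lemma even_card_sym_diff:
  assumes "finite A" "finite B"
  shows "even (card (sym_diff A B)) \<longleftrightarrow> (even (card A) \<longleftrightarrow> even (card B))"
proof -
  have "card (sym_diff A B) = card (A - B) + card (B - A)"
    using assms by (intro card_Un_disjoint) auto
  moreover have "card A = card (A - B) + card (A \<inter> B)" "card B = card (B - A) + card (A \<inter> B)"
    using assms card_Int_Diff[of A B] card_Int_Diff[of B A] by (auto simp: Int_commute)
  ultimately show ?thesis by auto
qed

section \<open>Copies of complete bipartite graphs as cuts\<close>

text \<open>Holds for arbitrary \<open>f\<close>, so it serves both for the isomorphism given by a
  copy and for one assembled from two bijections.\<close>

lemma image_edges_complete_bipartite:
  "image f ` edges (complete_bipartite a b) =
     {{x, y} | x y. x \<in> f ` Inl ` {1..a} \<and> y \<in> f ` Inr ` {1..b}}" (is "?L = ?R")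
proof
  show "?L \<subseteq> ?R"
  proof clarify
    fix e :: "(nat + nat) set"
    assume "e \<in> edges (complete_bipartite a b)"
    then obtain i j where ij: "i \<in> {1..a}" "j \<in> {1..b}" "e = {Inl i, Inr j}"
      unfolding complete_bipartite_def edges_def snd_conv by blast
    then have "f ` e = {f (Inl i), f (Inr j)}" by simp
    then show "\<exists>x y. f ` e = {x, y} \<and> x \<in> f ` Inl ` {1..a} \<and> y \<in> f ` Inr ` {1..b}"
      using ij by blast
  qed
  show "?R \<subseteq> ?L"
  proof clarify
    fix i j :: nat
    assume "i \<in> {1..a}" "j \<in> {1..b}"
    then have "{Inl i, Inr j} \<in> edges (complete_bipartite a b)"
      unfolding complete_bipartite_def edges_def snd_conv by blast
    then have "f ` {Inl i, Inr j} \<in> ?L" by (rule imageI)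
    then show "{f (Inl i), f (Inr j)} \<in> ?L" by simp
  qed
qed

text \<open>The copy has \<open>a + b\<close> vertices and is therefore spanning. The images of its
  two sides are then complementary, and as \<open>a\<close> and \<open>b\<close> are positive, both
  are nonempty.\<close>

lemma edges_copy_complete_bipartite:
  assumes C: "C \<in> copies (complete_bipartite a b) (complete_graph (a + b))"
    and "0 < a" "0 < b"
  obtains S where "S \<noteq> {}" "S \<subset> {1..a + b}" "edges C = cut_edges {1..a + b} S"
proof -
  let ?A = "Inl ` {1..a} :: (nat + nat) set" and ?B = "Inr ` {1..b} :: (nat + nat) set"
  let ?V = "{1..a + b}"
  from C obtain f where bij: "bij_betw f (?A \<union> ?B) (verts C)"
    and eC: "edges C = image f ` edges (complete_bipartite a b)"
    and sub: "verts C \<subseteq> ?V"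
    by (auto simp: copies_def isomorphic_def subgraph_def complete_graph_def
        complete_bipartite_def verts_def Plus_def)
  have "card (?A \<union> ?B) = a + b"
    by (subst card_Un_disjoint) (auto simp: card_image)
  then have V: "verts C = ?V"
    using bij_betw_same_card[OF bij] sub by (intro card_subset_eq) auto
  have im: "f ` ?A \<union> f ` ?B = ?V"
    using bij V by (auto simp: bij_betw_def image_Un)
  have disj: "f ` ?A \<inter> f ` ?B = {}"
    using bij inj_on_image_Int[of f "?A \<union> ?B" ?A ?B] by (auto simp: bij_betw_def)
  have compl: "?V - f ` ?A = f ` ?B"
    using im disj by blast
  have ne: "f ` ?A \<noteq> {}" "f ` ?B \<noteq> {}"
    using assms by auto
  have "edges C = cut_edges ?V (f ` ?A)"
    unfolding cut_edges_def compl eC image_edges_complete_bipartite ..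
  moreover have "f ` ?A \<subset> ?V"
    using im disj ne by blast
  ultimately show thesis using that[OF ne(1)] by simp
qed

lemma cut_in_copies:
  assumes "S \<subseteq> {1..n}" "card S = t"
  shows "({1..n}, cut_edges {1..n} S) \<in> copies (complete_bipartite t (n - t)) (complete_graph n)"
proof -
  let ?V = "{1..n}"
  have fin: "finite S" using assms finite_subset by blast
  have cd: "card (?V - S) = n - t"
    using assms fin by (simp add: card_Diff_subset)
  obtain g where g: "bij_betw g {1..t} S"
    using fin assms(2) by (metis card_atLeastAtMost diff_Suc_1 finite_atLeastAtMost finite_same_card_bij)
  obtain h where h: "bij_betw h {1..n - t} (?V - S)"
    using cd by (metis card_atLeastAtMost diff_Suc_1 finite_atLeastAtMost finite_Diff finite_same_card_bij)
  let ?f = "case_sum g h"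
  have gS: "g ` {1..t} = S" and hS: "h ` {1..n - t} = ?V - S"
    using g h by (auto simp: bij_betw_def)
  have "bij_betw ?f ({1..t} <+> {1..n - t}) ?V"
  proof -
    have gi: "g i \<in> S" if "i \<in> {1..t}" for i using gS that by blast
    have hj: "h j \<notin> S" if "j \<in> {1..n - t}" for j using hS that by blast
    have "inj_on ?f ({1..t} <+> {1..n - t})"
    \<comment> \<open>In the mixed cases, 2 and 3, one argument comes from each summand:
      \<open>g\<close> lands in \<open>S\<close> and \<open>h\<close> outside it, so the values
      cannot agree. The other two cases are injectivity of \<open>g\<close> and of
      \<open>h\<close>.\<close>
    proof (rule inj_onI, elim PlusE, goal_cases)
      case (2 _ _ i j)
      then show ?case using gi[of i] hj[of j] by simp
    next
      case (3 _ _ j i)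
      then show ?case using gi[of i] hj[of j] by simp
    qed (use g h in \<open>auto simp: bij_betw_def dest: inj_onD\<close>)
    moreover have "?f ` ({1..t} <+> {1..n - t}) = S \<union> (?V - S)"
      by (simp add: Plus_def image_Un image_image gS hS del: One_nat_def)
    ultimately show ?thesis
      using assms by (auto simp: bij_betw_def)
  qed
  moreover have "cut_edges ?V S = image ?f ` edges (complete_bipartite t (n - t))"
    unfolding image_edges_complete_bipartite cut_edges_def
    by (simp add: image_image gS hS del: One_nat_def)
  ultimately have "isomorphic (complete_bipartite t (n - t)) (?V, cut_edges ?V S)"
    by (auto simp: isomorphic_def complete_bipartite_def verts_def edges_def)
  then show ?thesis
    using cut_subset_nsets[OF assms(1)]
    by (simp add: copies_def subgraph_def simple_graph_def complete_graph_def verts_def edges_def)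
qed

text \<open>Allows the definition of \<open>odd_ramsey\<close> to be rewritten in terms of cuts
  alone. The bound \<open>t \<le> n div 2\<close> loses no cut, because a set and its complement
  have the same cut and one of them has at most \<open>n div 2\<close> elements.\<close>

lemma complete_bipartite_copies_odd_iff_cuts_odd:
  "(\<forall>H\<in>{complete_bipartite t (n - t) | t. t \<in> {1..n div 2}}.
      \<forall>C\<in>copies H (complete_graph n). has_odd_colour_class r c C) \<longleftrightarrow>
   (\<forall>S. S \<noteq> {} \<and> S \<subset> {1..n} \<longrightarrow> (\<exists>i\<in>{1..r}. odd (card (cut_edges {1..n} S \<inter> c i))))"
  (is "?L \<longleftrightarrow> ?R")
proof
  assume L: ?L
  show ?R
  proof (intro allI impI)
    fix S :: "nat set"
    assume S: "S \<noteq> {} \<and> S \<subset> {1..n}"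
    have small: "\<exists>i\<in>{1..r}. odd (card (cut_edges {1..n} T \<inter> c i))"
      if T: "T \<noteq> {}" "T \<subset> {1..n}" "card T \<le> n div 2" for T
    proof -
      have "finite T" using T finite_subset by blast
      then have "card T \<in> {1..n div 2}"
        using T by (simp add: Suc_le_eq card_gt_0_iff)
      then have "has_odd_colour_class r c ({1..n}, cut_edges {1..n} T)"
        using L cut_in_copies[of T n "card T"] T by blast
      then show ?thesis by (simp add: has_odd_colour_class_def edges_def)
    qed
    show "\<exists>i\<in>{1..r}. odd (card (cut_edges {1..n} S \<inter> c i))"
    proof (cases "card S \<le> n div 2")
      case True
      then show ?thesis using small S by blast
    next
      case False
      have "card ({1..n} - S) = n - card S"
        using S finite_subset[of S "{1..n}"] card_Diff_subset[of S "{1..n}"] by auto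
      then have "card ({1..n} - S) \<le> n div 2" using False by linarith
      moreover have "{1..n} - S \<noteq> {}" "{1..n} - S \<subset> {1..n}" "S \<subseteq> {1..n}" using S by blast+
      ultimately show ?thesis
        using small[of "{1..n} - S"] cut_Diff[of S "{1..n}"] by simp
    qed
  qed
next
  assume R: ?R
  show ?L
  proof (intro ballI)
    fix H and C :: "nat ugraph"
    assume "H \<in> {complete_bipartite t (n - t) | t. t \<in> {1..n div 2}}"
      and "C \<in> copies H (complete_graph n)"
    then obtain t where t: "t \<in> {1..n div 2}"
      and C: "C \<in> copies (complete_bipartite t (n - t)) (complete_graph n)"
      by blast
    \<comment> \<open>As \<open>1 \<le> t \<le> n div 2\<close>, the subtraction
      \<open>n - t\<close> is not truncated and both sides are nonempty.\<close>
    have n: "t + (n - t) = n" "0 < t" "0 < n - t" using t by auto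
    obtain S where "S \<noteq> {}" "S \<subset> {1..n}" "edges C = cut_edges {1..n} S"
      using edges_copy_complete_bipartite[of C t "n - t", unfolded n(1), OF C n(2,3)] .
    then show "has_odd_colour_class r c C"
      using R by (auto simp: has_odd_colour_class_def)
  qed
qed

section \<open>Lower bound\<close>

lemma exists_cut_even_in_few_colours:
  assumes "finite V" "finite I" "card I < card V - 1"
  obtains S where "S \<noteq> {}" "S \<subset> V" "\<And>i. i \<in> I \<Longrightarrow> even (card (cut_edges V S \<inter> c i))"
proof -
  obtain v where v: "v \<in> V" using assms(3) by fastforce
  \<comment> \<open>Subsets avoiding \<open>v\<close> have a symmetric difference avoiding
    \<open>v\<close>, hence different from \<open>V\<close>. \<open>?p\<close> records the parity
    vector of a cut as the set of its odd colours.\<close>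
  let ?W = "V - {v}"
  let ?p = "\<lambda>S. {i \<in> I. odd (card (cut_edges V S \<inter> c i))}"
  have "card (?p ` Pow ?W) \<le> card (Pow I)"
    using assms by (intro card_mono) auto
  also have "\<dots> < card (Pow ?W)"
    using assms v by (simp add: card_Pow)
  finally have "\<not> inj_on ?p (Pow ?W)" by (rule pigeonhole)
  then obtain S T where ST: "S \<subseteq> ?W" "T \<subseteq> ?W" "?p S = ?p T" "S \<noteq> T"
    by (auto simp: inj_on_def)
  then have sub: "S \<subseteq> V" "T \<subseteq> V" by auto
  show thesis
  proof
    show "sym_diff S T \<noteq> {}" "sym_diff S T \<subset> V" using ST v by auto
    fix i assume "i \<in> I"
    then have eq: "even (card (cut_edges V S \<inter> c i)) \<longleftrightarrow> even (card (cut_edges V T \<inter> c i))"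
      using ST(3) by blast
    have "cut_edges V (sym_diff S T) \<inter> c i = sym_diff (cut_edges V S \<inter> c i) (cut_edges V T \<inter> c i)"
      using cut_sym_diff[OF sub] by blast
    then show "even (card (cut_edges V (sym_diff S T) \<inter> c i))"
      using eq even_card_sym_diff finite_cut[OF assms(1)] sub by (metis finite_Int)
  qed
qed

lemma colours_lower_bound:
  assumes "0 < r" and col: "edge_colouring r c (complete_graph n)"
    and odd: "\<And>S. S \<noteq> {} \<Longrightarrow> S \<subset> {1..n} \<Longrightarrow> \<exists>i\<in>{1..r}. odd (card (cut_edges {1..n} S \<inter> c i))"
  shows "(if even n then n - 1 else n) \<le> r"
proof (rule ccontr)
  let ?V = "{1..n}"
  assume "\<not> ?thesis"
  then have less: "(if even n then n - 1 else n) > r" by simp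
  show False
  proof (cases "even n")
    case True
    then obtain S where "S \<noteq> {}" "S \<subset> ?V" "\<And>i. i \<in> {1..r} \<Longrightarrow> even (card (cut_edges ?V S \<inter> c i))"
      using less exists_cut_even_in_few_colours[of ?V "{1..r}" c] by auto
    then show False using odd by blast
  next
    case False
    \<comment> \<open>Here only \<open>r < n\<close> is known, so colour \<open>r\<close> is set
      aside: the remaining \<open>r - 1 < n - 1\<close> colours can all be made even.\<close>
    then obtain S where S: "S \<noteq> {}" "S \<subset> ?V"
      and ev: "\<And>i. i \<in> {1..<r} \<Longrightarrow> even (card (cut_edges ?V S \<inter> c i))"
      using less assms(1) exists_cut_even_in_few_colours[of ?V "{1..<r}" c]
      by (auto simp: diff_less_mono)
    have sub: "S \<subseteq> ?V" and fin: "finite S" using S finite_subset by blast+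
    have "cut_edges ?V S = (\<Union>i\<in>{1..r}. cut_edges ?V S \<inter> c i)"
      using col cut_subset_nsets[OF sub]
      by (auto simp: edge_colouring_def complete_graph_def edges_def)
    moreover have "card (\<Union>i\<in>{1..r}. cut_edges ?V S \<inter> c i) = (\<Sum>i\<in>{1..r}. card (cut_edges ?V S \<inter> c i))"
      using col finite_cut[of ?V S] sub
      by (intro card_UN_disjoint) (auto simp: edge_colouring_def disjoint_family_on_def)
    ultimately have "card (cut_edges ?V S) = (\<Sum>i\<in>{1..r}. card (cut_edges ?V S \<inter> c i))" by simp
    also have "{1..r} = insert r {1..<r}" using assms(1) by auto
    finally have "card (cut_edges ?V S) = card (cut_edges ?V S \<inter> c r) + (\<Sum>i\<in>{1..<r}. card (cut_edges ?V S \<inter> c i))"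
      by simp
    moreover have "even (\<Sum>i\<in>{1..<r}. card (cut_edges ?V S \<inter> c i))" using ev by (intro dvd_sum) auto
    \<comment> \<open>As \<open>n\<close> is odd, one of \<open>card S\<close> and
      \<open>n - card S\<close> is even, and so is their product.\<close>
    moreover have "even (card (cut_edges ?V S))"
      using False sub fin card_mono[OF _ sub]
      by (simp add: card_cut card_Diff_subset)
    ultimately have "even (card (cut_edges ?V S \<inter> c r))" by simp
    then have "even (card (cut_edges ?V S \<inter> c i))" if "i \<in> {1..r}" for i
      using ev that by (cases "i = r") auto
    then show False using odd S by blast
  qed
qed

section \<open>Upper bound\<close>

definition star_colouring :: "nat \<Rightarrow> nat \<Rightarrow> nat \<Rightarrow> nat set set" where
  "star_colouring n k i =
     (if i < n then {{i, n}} else {}) \<union> (if i = k then [{1..<n}]\<^bsup>2\<^esup> else {})"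

lemma star_colouring_edge_colouring:
  assumes "0 < k" "k \<le> r" "n - 1 \<le> r" "r \<le> n"
  shows "edge_colouring r (star_colouring n k) (complete_graph n)"
proof -
  have "disjoint_family_on (star_colouring n k) {1..r}"
    by (auto simp: disjoint_family_on_def star_colouring_def nsets_def doubleton_eq_iff)
  moreover have "e \<in> [{1..n}]\<^bsup>2\<^esup>" if "e \<in> star_colouring n k i" "i \<in> {1..r}" for e i
    using that by (auto simp: star_colouring_def nsets_def split: if_splits)
  moreover have "\<exists>i\<in>{1..r}. e \<in> star_colouring n k i" if "e \<in> [{1..n}]\<^bsup>2\<^esup>" for e
  proof (cases "n \<in> e")
    case True
    then obtain x where "e = {x, n}" "x \<in> {1..<n}"
      using \<open>e \<in> [{1..n}]\<^bsup>2\<^esup>\<close> by (fastforce simp: nsets_def card_2_iff)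
    then show ?thesis using assms by (intro bexI[of _ x]) (auto simp: star_colouring_def)
  next
    case False
    then have "e \<in> [{1..<n}]\<^bsup>2\<^esup>"
      using that by (auto simp: nsets_def subset_iff) (metis le_neq_implies_less)
    then show ?thesis using assms by (intro bexI[of _ k]) (auto simp: star_colouring_def)
  qed
  ultimately show ?thesis
    unfolding edge_colouring_def complete_graph_def edges_def snd_conv by blast
qed

text \<open>Passing to the complement if necessary, assume that \<open>n\<close> is outside the set.
  Any element \<open>i\<close> other than \<open>k\<close> gives a colour met by the cut in the
  single edge \<open>{i, n}\<close>. Otherwise the set is \<open>{k}\<close>, and its cut is a star
  of a single colour.\<close>

lemma star_colouring_cut_odd:
  assumes "S \<noteq> {}" "S \<subset> {1..n}" and k: "k = n \<and> r = n \<or> k = 1 \<and> even n \<and> r = n - 1"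
  shows "\<exists>i\<in>{1..r}. odd (card (cut_edges {1..n} S \<inter> star_colouring n k i))"
proof -
  let ?V = "{1..n}"
  have main: "\<exists>i\<in>{1..r}. odd (card (cut_edges ?V T \<inter> star_colouring n k i))"
    if T: "T \<noteq> {}" "T \<subseteq> {1..<n}" for T
  proof -
    have TV: "T \<subseteq> ?V" using T by auto
    have nT: "n \<notin> T" using T by auto
    show ?thesis
    proof (cases "\<exists>i\<in>T. i \<noteq> k")
      case True
      then obtain i where i: "i \<in> T" "i \<noteq> k" by blast
      then have "i \<in> {1..<n}" using T by blast
      moreover from this have "{i, n} \<in> cut_edges ?V T"
        using doubleton_in_cut_iff[OF TV, of i n] i nT by auto
      then have "cut_edges ?V T \<inter> star_colouring n k i = {{i, n}}"
        using i \<open>i \<in> {1..<n}\<close> by (auto simp: star_colouring_def)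
      ultimately show ?thesis using k by (intro bexI[of _ i]) auto
    next
      case False
      then have Tk: "T = {k}" using T by auto
      \<comment> \<open>The alternative \<open>k = n\<close> is excluded because \<open>n\<close> is
        not in \<open>T\<close>.\<close>
      with nT k have k1: "k = 1" "even n" "r = n - 1" by auto
      have "1 < n" using T Tk k1 by auto
      \<comment> \<open>The edge \<open>{1, n}\<close> and all edges from 1 to vertices below
        \<open>n\<close> have colour 1. These are \<open>n - 1\<close> edges, an odd number since
        \<open>n\<close> is even.\<close>
      have "cut_edges ?V T \<subseteq> star_colouring n k 1"
        using \<open>1 < n\<close> unfolding cut_edges_def Tk k1
        by (auto simp: star_colouring_def nsets_def card_insert_if)
      then have "cut_edges ?V T \<inter> star_colouring n k 1 = cut_edges ?V T" by blast
      moreover have "card (cut_edges ?V T) = n - 1"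
        using card_cut[OF TV] Tk k1 \<open>1 < n\<close> by (simp add: card_Diff_subset)
      ultimately show ?thesis using k1 \<open>1 < n\<close> by (intro bexI[of _ 1]) auto
    qed
  qed
  show ?thesis
  proof (cases "n \<in> S")
    case True
    have "{1..n} - S \<subseteq> {1..<n}"
      using True by (auto simp: order_less_le)
    then show ?thesis
      using main[of "{1..n} - S"] assms(2) cut_Diff[of S ?V] by auto
  next
    case False
    have "S \<subseteq> {1..<n}"
      using False assms(2) by (force simp: order_less_le)
    then show ?thesis using main assms(1) by blast
  qed
qed

theorem theorem1p1:
  fixes n :: nat
  assumes "n > 0"
  shows "odd_ramsey n {complete_bipartite t (n - t) | t. t \<in> {1..n div 2}}
           = (if even n then n - 1 else n)" (is "_ = ?r")
  unfolding odd_ramsey_def complete_bipartite_copies_odd_iff_cuts_odd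
proof (rule Least_equality)
  let ?k = "if even n then 1 else n"
  \<comment> \<open>A positive even \<open>n\<close> is at least 2, so \<open>n - 1\<close> is
    positive.\<close>
  have r: "0 < ?r" using assms by (auto elim: evenE)
  have "edge_colouring ?r (star_colouring n ?k) (complete_graph n)"
    using assms r by (intro star_colouring_edge_colouring) (auto split: if_splits)
  moreover have "\<exists>i\<in>{1..?r}. odd (card (cut_edges {1..n} S \<inter> star_colouring n ?k i))"
    if "S \<noteq> {}" "S \<subset> {1..n}" for S
    using that by (intro star_colouring_cut_odd) auto
  ultimately show "0 < ?r \<and> (\<exists>c. edge_colouring ?r c (complete_graph n) \<and>
      (\<forall>S. S \<noteq> {} \<and> S \<subset> {1..n} \<longrightarrow> (\<exists>i\<in>{1..?r}. odd (card (cut_edges {1..n} S \<inter> c i)))))"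
    using r by blast
next
  fix r
  assume *: "0 < r \<and> (\<exists>c. edge_colouring r c (complete_graph n) \<and>
      (\<forall>S. S \<noteq> {} \<and> S \<subset> {1..n} \<longrightarrow> (\<exists>i\<in>{1..r}. odd (card (cut_edges {1..n} S \<inter> c i)))))"
  then obtain c where "edge_colouring r c (complete_graph n)"
    "\<forall>S. S \<noteq> {} \<and> S \<subset> {1..n} \<longrightarrow> (\<exists>i\<in>{1..r}. odd (card (cut_edges {1..n} S \<inter> c i)))"
    by blast
  then show "?r \<le> r"
    using * by (intro colours_lower_bound) auto
qed

end
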